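(* Let $\alpha\in(0,2)$ and $p\in(1,\infty)$. There is a constant $C>0$ such that for every nonnegative $f\in L^p(\mathbb{R}^n)$, $$\int_0^\infty C^{\alpha,p}_{\mathbb{R}^{n+1}_+}\left(\left\{(x,t)\in\mathbb{R}^{n+1}_+:\ P_\alpha f(x,t)\ge\lambda\right\}\right)d\lambda^p\le C\,\|f\|^p_{L^p(\mathbb{R}^n)}.$$
   Context: $\mathbb{R}^{n+1}_+:=\mathbb{R}^n\times(0,\infty)$, $n\ge1$. For $\alpha\in(0,2)$, $p^\alpha_t(x)=c(n,\alpha)\,t^\alpha(|x|^2+t^2)^{-(n+\alpha)/2}$ with $c(n,\alpha)=\frac{\Gamma((n+\alpha)/2)}{\pi^{n/2}\Gamma(\alpha/2)}$, and $P_\alpha f(x,t)=\int_{\mathbb{R}^n}p^\alpha_t(x-y)f(y)\,dy$ is the Caffarelli-Silvestre extension. The $L^p$-capacity is $C^{\alpha,p}_{\mathbb{R}^{n+1}_+}(E):=\inf\{\|f\|^p_{L^p(\mathbb{R}^n)}:\ f\ge0,\ P_\alpha f(x,t)\ge1\text{ for all }(x,t)\in E\}$ for $E\subset\mathbb{R}^{n+1}_+$. The notation $d\lambda^p$ means $p\lambda^{p-1}d\lambda$. *)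

theory Defs
  imports "HOL-Analysis.Analysis"
begin

definition upper_half_space :: "((real ^ 'n) \<times> real) set" where
  "upper_half_space = UNIV \<times> {0<..}"

text \<open>Functions are not identified up to null sets: membership in \<open>L\<^sup>p\<close> is a property of
  a representative, and nonnegativity of an element of \<open>L\<^sup>p\<close> is expressed almost everywhere.\<close>

definition Lp_space :: "real \<Rightarrow> (real ^ 'n \<Rightarrow> real) set" where
  "Lp_space p = {f \<in> borel_measurable lebesgue. integrable lebesgue (\<lambda>x. \<bar>f x\<bar> powr p)}"

definition Lp_norm :: "real \<Rightarrow> (real ^ 'n \<Rightarrow> real) \<Rightarrow> real" where
  "Lp_norm p f = (\<integral>x. \<bar>f x\<bar> powr p \<partial>lebesgue) powr (1 / p)"

definition CS_const :: "nat \<Rightarrow> real \<Rightarrow> real" where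
  "CS_const n \<alpha> = Gamma ((real n + \<alpha>) / 2) / (pi powr (real n / 2) * Gamma (\<alpha> / 2))"

definition CS_kernel :: "real \<Rightarrow> real \<Rightarrow> real ^ 'n \<Rightarrow> real" where
  "CS_kernel \<alpha> t x =
     CS_const CARD('n) \<alpha> * t powr \<alpha> *
     ((norm x)\<^sup>2 + t\<^sup>2) powr (- (real CARD('n) + \<alpha>) / 2)"

text \<open>For \<open>t > 0\<close> and \<open>f \<in> L\<^sup>p\<close> with \<open>1 < p < \<infinity>\<close> the integral converges by Hoelder's
  inequality, so the default value of the Bochner integral at non-integrable functions
  plays no role there.\<close>

definition CS_extension :: "real \<Rightarrow> (real ^ 'n \<Rightarrow> real) \<Rightarrow> real ^ 'n \<Rightarrow> real \<Rightarrow> real" where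
  "CS_extension \<alpha> f x t = (\<integral>y. CS_kernel \<alpha> t (x - y) * f y \<partial>lebesgue)"

text \<open>The infimum is taken in \<open>[0, \<infinity>]\<close>, so it is \<open>\<infinity>\<close> when there is no admissible function.
  Nonnegative functions outside \<open>L\<^sup>p\<close> could only contribute the value \<open>\<infinity>\<close>, so restricting
  to \<open>L\<^sup>p\<close> does not change it.  Only sets \<open>E\<close> contained in the upper half space are meaningful
  arguments.\<close>

definition Lp_capacity :: "real \<Rightarrow> real \<Rightarrow> ((real ^ 'n) \<times> real) set \<Rightarrow> ennreal" where
  "Lp_capacity \<alpha> p E =
     (INF f \<in> {f \<in> Lp_space p. (AE x in lebesgue. 0 \<le> f x) \<and>
                               (\<forall>(x, t) \<in> E. 1 \<le> CS_extension \<alpha> f x t)}.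
        ennreal (Lp_norm p f powr p))"

end

theory Submission
  imports Defs
begin

text \<open>
  Splitting \<open>\<real>\<^sup>n\<close> into dyadic annuli around \<open>x\<close> bounds \<open>P\<^sub>\<alpha> f(x, t)\<close> by a geometrically weighted sum
  of the averages of \<open>f\<close> over the balls \<open>B(x, 2\<^sup>j t)\<close>.  Hence \<open>P\<^sub>\<alpha> f(x, t) \<ge> s\<close> forces the average of \<open>f\<close>,
  and even of its truncation \<open>f 1\<^bsub>{f > c s}\<^esub>\<close>, to be at least a multiple of \<open>s\<close> on some ball
  containing \<open>B(x, t)\<close>.  By Vitali's covering lemma the union \<open>G(s)\<close> of all these \<open>B(x, t)\<close> satisfies
  \<open>|G(s)| \<le> (D / s) \<integral>\<^bsub>{f > c s}\<^esub> f\<close>.  On the other hand \<open>P\<^sub>\<alpha> 1\<^bsub>G(s)\<^esub>\<close> is bounded below on the level set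
  \<open>{P\<^sub>\<alpha> f \<ge> s}\<close>, because \<open>G(s)\<close> contains \<open>B(x, t)\<close>; so a multiple of \<open>1\<^bsub>G(s)\<^esub>\<close> is admissible and the
  capacity of the level set is at most a multiple of \<open>|G(s)|\<close>.  Integrating in \<open>s\<close> and applying
  Tonelli's theorem gives the claim.
\<close>

section \<open>Covering estimate of weak type\<close>

lemma emeasure_UN_countable_le:
  assumes X: "\<And>i. i \<in> I \<Longrightarrow> X i \<in> sets M" and I: "countable I"
  shows "emeasure M (\<Union>i\<in>I. X i) \<le> (\<integral>\<^sup>+ i. emeasure M (X i) \<partial>count_space I)"
proof -
  have "emeasure M (\<Union>i\<in>I. X i) = (\<integral>\<^sup>+ y. indicator (\<Union>i\<in>I. X i) y \<partial>M)"
    using assms by (intro nn_integral_indicator[symmetric] sets.countable_UN') auto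
  \<comment> \<open>A point of the union lies in at least one \<open>X i\<close>, so counting the
    sets that contain it gives at least 1; Tonelli then exchanges the count with the
    integral.\<close>
  also have "\<dots> \<le> (\<integral>\<^sup>+ y. (\<integral>\<^sup>+ i. indicator (X i) y \<partial>count_space I) \<partial>M)"
  proof (intro nn_integral_mono)
    fix y
    show "indicator (\<Union>i\<in>I. X i) y \<le> (\<integral>\<^sup>+ i. indicator (X i) y \<partial>count_space I)"
    proof (cases "y \<in> (\<Union>i\<in>I. X i)")
      case True
      then obtain i where i: "i \<in> I" "y \<in> X i" by blast
      have "indicator (\<Union>i\<in>I. X i) y = (indicator (X i) y :: ennreal)"
        using True i by (simp only: indicator_simps)
      also have "\<dots> \<le> (\<integral>\<^sup>+ i. indicator (X i) y \<partial>count_space I)"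
        by (rule nn_integral_ge_point[OF i(1)])
      finally show ?thesis .
    qed simp
  qed
  also have "\<dots> = (\<integral>\<^sup>+ i. (\<integral>\<^sup>+ y. indicator (X i) y \<partial>M) \<partial>count_space I)"
    using assms by (intro nn_integral_count_space_nn_integral[where f="\<lambda>i. indicator (X i)"]) auto
  also have "\<dots> = (\<integral>\<^sup>+ i. emeasure M (X i) \<partial>count_space I)"
    using assms by (intro nn_integral_cong) auto
  finally show ?thesis .
qed

text \<open>Vitali's lemma selects countably many disjoint balls whose five-fold enlargements still
  cover \<open>S\<close>. An enlarged ball has measure
  \<open>unit_ball_vol DIM('a) * 5 ^ DIM('a) * r i ^ DIM('a)\<close>, which \<open>avg\<close>
  bounds by the integral of \<open>g\<close> over the original ball, and disjointness lets these
  integrals add up to at most the total integral.\<close>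

lemma emeasure_le_of_averages_ge:
  fixes a :: "'i \<Rightarrow> 'a::euclidean_space" and g :: "'a \<Rightarrow> ennreal"
  assumes g: "g \<in> borel_measurable borel"
    and S: "S \<subseteq> (\<Union>i\<in>K. cball (a i) (r i))"
    and r: "\<And>i. i \<in> K \<Longrightarrow> 0 < r i"
    and \<mu>: "0 < \<mu>"
    and avg: "\<And>i. i \<in> K \<Longrightarrow>
      ennreal (\<mu> * r i ^ DIM('a)) \<le> (\<integral>\<^sup>+ x \<in> cball (a i) (r i). g x \<partial>lborel)"
  shows "emeasure lborel S
    \<le> ennreal (unit_ball_vol DIM('a) * 5 ^ DIM('a) / \<mu>) * (\<integral>\<^sup>+ x. g x \<partial>lborel)"
proof (cases "(\<integral>\<^sup>+ x. g x \<partial>lborel) = \<infinity>")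
  case True
  have "unit_ball_vol DIM('a) \<noteq> 0" by (intro less_imp_neq[symmetric] unit_ball_vol_pos) simp
  then show ?thesis using True \<mu> by (simp add: ennreal_mult_top)
next
  case False
  then obtain I where I: "0 \<le> I" "(\<integral>\<^sup>+ x. g x \<partial>lborel) = ennreal I"
    by (cases "\<integral>\<^sup>+ x. g x \<partial>lborel") auto
  \<comment> \<open>Vitali's lemma asks for bounded radii. A radius above 1 is at most its own
    \<open>DIM('a)\<close>-th power, and \<open>avg\<close> bounds that power by
    \<open>I / \<mu>\<close> because the total integral is finite.\<close>
  have r_le: "0 < r i \<and> r i \<le> max 1 (I / \<mu>)" if "i \<in> K" for i
  proof (cases "r i \<le> 1")
    case False
    have "ennreal (\<mu> * r i ^ DIM('a)) \<le> ennreal I"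
      unfolding I(2)[symmetric]
      by (rule order_trans[OF avg[OF that]]) (auto intro!: nn_integral_mono simp: indicator_def)
    then have "r i ^ DIM('a) \<le> I / \<mu>"
      using \<mu> I r[OF that] by (simp add: field_simps)
    moreover have "r i ^ 1 \<le> r i ^ DIM('a)"
      using False by (intro power_increasing) (auto simp: Suc_leI)
    ultimately show ?thesis using r[OF that] by simp
  qed (use r[OF that] in auto)
  obtain C where C: "countable C" "C \<subseteq> K"
      "pairwise (\<lambda>i j. disjnt (cball (a i) (r i)) (cball (a j) (r j))) C"
      "S \<subseteq> (\<Union>i\<in>C. cball (a i) (5 * r i))"
    by (rule Vitali_covering_lemma_cballs[OF S]) (erule r_le, erule (3) that)
  let ?c = "unit_ball_vol DIM('a) * 5 ^ DIM('a) / \<mu>"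
  have "emeasure lborel S \<le> emeasure lborel (\<Union>i\<in>C. cball (a i) (5 * r i))"
    using C by (intro emeasure_mono) auto
  also have "\<dots> \<le> (\<integral>\<^sup>+ i. emeasure lborel (cball (a i) (5 * r i)) \<partial>count_space C)"
    using C by (intro emeasure_UN_countable_le) auto
  also have "\<dots> \<le> (\<integral>\<^sup>+ i. ennreal ?c * (\<integral>\<^sup>+ x \<in> cball (a i) (r i). g x \<partial>lborel) \<partial>count_space C)"
  proof (intro nn_integral_mono)
    fix i assume "i \<in> space (count_space C)"
    then have i: "i \<in> K" using C by auto
    have "emeasure lborel (cball (a i) (5 * r i)) = ennreal (?c * (\<mu> * r i ^ DIM('a)))"
      using r[OF i] \<mu> by (simp add: emeasure_cball power_mult_distrib)
    also have "\<dots> = ennreal ?c * ennreal (\<mu> * r i ^ DIM('a))"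
      using \<mu> r[OF i] by (intro ennreal_mult) auto
    also have "\<dots> \<le> ennreal ?c * (\<integral>\<^sup>+ x \<in> cball (a i) (r i). g x \<partial>lborel)"
      by (intro mult_left_mono avg i) auto
    finally show "emeasure lborel (cball (a i) (5 * r i)) \<le> \<dots>" .
  qed
  also have "\<dots> = ennreal ?c * (\<integral>\<^sup>+ i. (\<integral>\<^sup>+ x \<in> cball (a i) (r i). g x \<partial>lborel) \<partial>count_space C)"
    by (intro nn_integral_cmult) auto
  \<comment> \<open>Read as values of the measure with density \<open>g\<close>, the integrals over
    disjoint balls sum to the measure of the union.\<close>
  also have "\<dots> = ennreal ?c * (\<integral>\<^sup>+ i. emeasure (density lborel g) (cball (a i) (r i)) \<partial>count_space C)"
    using g by (simp add: emeasure_density)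
  also have "\<dots> = ennreal ?c * emeasure (density lborel g) (\<Union>i\<in>C. cball (a i) (r i))"
    using C by (subst emeasure_UN_countable)
      (auto simp: disjoint_family_on_def pairwise_def disjnt_def)
  also have "\<dots> \<le> ennreal ?c * emeasure (density lborel g) (space (density lborel g))"
    by (intro mult_left_mono emeasure_space) auto
  also have "\<dots> = ennreal ?c * (\<integral>\<^sup>+ x. g x \<partial>lborel)"
    using g by (simp add: emeasure_density)
  finally show ?thesis .
qed

section \<open>Two-sided bounds for the kernel\<close>

lemma CS_const_pos: "0 < n \<Longrightarrow> 0 < \<alpha> \<Longrightarrow> 0 < CS_const n \<alpha>"
  unfolding CS_const_def by (intro divide_pos_pos mult_pos_pos Gamma_real_pos) auto

lemma CS_kernel_nonneg: "0 < \<alpha> \<Longrightarrow> 0 \<le> CS_kernel \<alpha> t (z :: real ^ 'n)"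
  unfolding CS_kernel_def using CS_const_pos[of "CARD('n)" \<alpha>] by simp

lemma continuous_on_CS_kernel:
  assumes "0 < t"
  shows "continuous_on UNIV (CS_kernel \<alpha> t :: real ^ 'n \<Rightarrow> real)"
proof -
  have "(norm z)\<^sup>2 + t\<^sup>2 \<noteq> 0" for z :: "real ^ 'n"
    using assms by (simp add: add_nonneg_eq_0_iff)
  then show ?thesis
    unfolding CS_kernel_def by (intro continuous_intros) auto
qed

text \<open>For |z| at most t the bracket in the kernel is at most 2 t^2, and the powers of t
  combine to t^(-n). This is the source of the lower bound for extensions of indicators.\<close>

lemma CS_kernel_ge:
  fixes z :: "real ^ 'n"
  assumes "0 < \<alpha>" "0 < t" "norm z \<le> t"
  shows "CS_const CARD('n) \<alpha> * 2 powr (- (real CARD('n) + \<alpha>) / 2) / t ^ CARD('n) \<le> CS_kernel \<alpha> t z"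
proof -
  let ?n = "real CARD('n)"
  have "(norm z)\<^sup>2 + t\<^sup>2 \<le> 2 * t\<^sup>2"
    using assms power_mono[of "norm z" t 2] by simp
  then have 1: "(2 * t\<^sup>2) powr (- (?n + \<alpha>) / 2) \<le> ((norm z)\<^sup>2 + t\<^sup>2) powr (- (?n + \<alpha>) / 2)"
    using assms by (intro powr_mono2') (auto intro: add_nonneg_pos)
  have "(t\<^sup>2) powr (- (?n + \<alpha>) / 2) = t powr (2 * (- (?n + \<alpha>) / 2))"
    using assms by (simp only: powr_powr flip: powr_numeral)
  also have "2 * (- (?n + \<alpha>) / 2) = - (?n + \<alpha>)" by simp
  finally have 2: "(2 * t\<^sup>2) powr (- (?n + \<alpha>) / 2) = 2 powr (- (?n + \<alpha>) / 2) * t powr (- (?n + \<alpha>))"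
    using assms by (simp only: powr_mult)
  have 3: "t powr \<alpha> * t powr (- (?n + \<alpha>)) = 1 / t ^ CARD('n)"
    using assms by (simp add: powr_realpow[symmetric] powr_minus_divide flip: powr_add)
  have "CS_const CARD('n) \<alpha> * 2 powr (- (?n + \<alpha>) / 2) / t ^ CARD('n)
    = CS_const CARD('n) \<alpha> * 2 powr (- (?n + \<alpha>) / 2) * (1 / t ^ CARD('n))" by simp
  also have "\<dots> = CS_const CARD('n) \<alpha> * t powr \<alpha> * (2 * t\<^sup>2) powr (- (?n + \<alpha>) / 2)"
    unfolding 2 3[symmetric] by (simp only: ac_simps)
  also have "\<dots> \<le> CS_kernel \<alpha> t z"
    unfolding CS_kernel_def using assms CS_const_pos[of "CARD('n)" \<alpha>]
    by (intro mult_left_mono 1) auto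
  finally show ?thesis .
qed

text \<open>With R = 2^j t, the kernel is at most a constant times t^\<alpha> (R/2)^(-(n+\<alpha>)).
  Splitting off R^(-n) as the averaging factor leaves (t/R)^\<alpha> = 2^(-\<alpha> j), the
  geometric decay.\<close>

lemma CS_kernel_le_dyadic_term:
  fixes z :: "real ^ 'n"
  assumes "0 < \<alpha>" "0 < t" "2 ^ j * t / 2 \<le> sqrt ((norm z)\<^sup>2 + t\<^sup>2)"
  shows "CS_kernel \<alpha> t z \<le> CS_const CARD('n) \<alpha> * 2 powr (real CARD('n) + \<alpha>)
    * (2 powr - \<alpha>) ^ j / (2 ^ j * t) ^ CARD('n)"
proof -
  let ?n = "real CARD('n)" and ?R = "2 ^ j * t"
  have R: "?R > 0" using assms by simp
  have s: "(norm z)\<^sup>2 + t\<^sup>2 > 0" using assms by (intro add_nonneg_pos) auto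
  have "((norm z)\<^sup>2 + t\<^sup>2) powr (- (?n + \<alpha>) / 2) = sqrt ((norm z)\<^sup>2 + t\<^sup>2) powr (- (?n + \<alpha>))"
    using s by (simp add: powr_powr flip: powr_half_sqrt)
  also have "\<dots> \<le> (?R / 2) powr (- (?n + \<alpha>))"
    using assms by (intro powr_mono2') auto
  also have "\<dots> = 2 powr (?n + \<alpha>) * ?R powr (- (?n + \<alpha>))"
    using R by (simp only: powr_divide powr_minus) (simp add: field_simps)
  finally have 1: "((norm z)\<^sup>2 + t\<^sup>2) powr (- (?n + \<alpha>) / 2) \<le> 2 powr (?n + \<alpha>) * ?R powr (- (?n + \<alpha>))" .
  have "?R powr (- (?n + \<alpha>)) = ?R powr - \<alpha> * ?R powr - ?n"
    by (simp only: powr_add[symmetric] minus_add_distrib add.commute)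
  also have "?R powr - ?n = 1 / ?R ^ CARD('n)"
    using R by (simp only: powr_minus_divide powr_realpow)
  also have "?R powr - \<alpha> = (2 powr - \<alpha>) ^ j * t powr - \<alpha>"
  proof -
    have "(2 powr - \<alpha>) ^ j = (2 powr real j) powr - \<alpha>"
      by (simp add: powr_power powr_powr mult.commute)
    then show ?thesis using assms by (simp add: powr_mult powr_realpow)
  qed
  finally have 2: "t powr \<alpha> * ?R powr (- (?n + \<alpha>)) = (2 powr - \<alpha>) ^ j / ?R ^ CARD('n)"
    using assms by (simp add: powr_minus)
  have "CS_kernel \<alpha> t z \<le> CS_const CARD('n) \<alpha> * t powr \<alpha> * (2 powr (?n + \<alpha>) * ?R powr (- (?n + \<alpha>)))"
    unfolding CS_kernel_def using CS_const_pos[of "CARD('n)" \<alpha>] assms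
    by (intro mult_left_mono 1) auto
  also have "\<dots> = CS_const CARD('n) \<alpha> * 2 powr (?n + \<alpha>) * (t powr \<alpha> * ?R powr (- (?n + \<alpha>)))"
    by simp
  finally show ?thesis unfolding 2 by simp
qed

text \<open>For the least j with |z| at most 2^j t, the j-th summand alone dominates the kernel,
  since z lies outside the next smaller ball; the other summands are nonnegative.\<close>

lemma CS_kernel_le_dyadic:
  fixes z :: "real ^ 'n"
  assumes "0 < \<alpha>" "0 < t"
  shows "ennreal (CS_kernel \<alpha> t z) \<le> (\<Sum>j. ennreal (CS_const CARD('n) \<alpha> * 2 powr (real CARD('n) + \<alpha>)
    * (2 powr - \<alpha>) ^ j / (2 ^ j * t) ^ CARD('n)) * indicator (cball 0 (2 ^ j * t)) z)"
    (is "_ \<le> (\<Sum>j. ennreal (?w j) * _ j)")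
proof -
  obtain m :: nat where "norm z / t < 2 ^ m"
    using real_arch_pow[of 2 "norm z / t"] by auto
  then have m: "norm z \<le> 2 ^ m * t" using assms by (simp add: field_simps)
  define j where "j = (LEAST j. norm z \<le> 2 ^ j * t)"
  have j: "norm z \<le> 2 ^ j * t" unfolding j_def by (rule LeastI, rule m)
  have "2 ^ j * t / 2 \<le> sqrt ((norm z)\<^sup>2 + t\<^sup>2)"
  proof (cases j)
    case 0
    \<comment> \<open>For j = 0 there is no smaller ball to lie outside of; the t under the root
      gives the bound instead.\<close>
    have "t \<le> sqrt ((norm z)\<^sup>2 + t\<^sup>2)" by (rule real_sqrt_sum_squares_ge2)
    then have "t / 2 \<le> sqrt ((norm z)\<^sup>2 + t\<^sup>2)" using assms by linarith
    then show ?thesis using 0 by simp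
  next
    case (Suc i)
    then have "\<not> norm z \<le> 2 ^ i * t" unfolding j_def by (intro not_less_Least) auto
    moreover have "norm z \<le> sqrt ((norm z)\<^sup>2 + t\<^sup>2)" by (rule real_sqrt_sum_squares_ge1)
    ultimately have "2 ^ i * t \<le> sqrt ((norm z)\<^sup>2 + t\<^sup>2)" by linarith
    then show ?thesis using Suc by simp
  qed
  then have "ennreal (CS_kernel \<alpha> t z) \<le> ennreal (?w j) * indicator (cball 0 (2 ^ j * t)) z"
    using CS_kernel_le_dyadic_term[of \<alpha> t j z] assms j by (simp add: ennreal_leI)
  also have "\<dots> = (\<Sum>i\<in>{j}. ennreal (?w i) * indicator (cball 0 (2 ^ i * t)) z)"
    by (simp only: sum.insert sum.empty finite.emptyI empty_iff not_False_eq_True add_0_right)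
  also have "\<dots> \<le> (\<Sum>i. ennreal (?w i) * indicator (cball 0 (2 ^ i * t)) z)"
    by (intro sum_le_suminf) auto
  finally show ?thesis .
qed

section \<open>From level sets to large averages\<close>

lemma ennreal_integral_le_nn_integral:
  fixes h :: "'a \<Rightarrow> real"
  shows "ennreal (\<integral>x. h x \<partial>M) \<le> (\<integral>\<^sup>+ x. ennreal (h x) \<partial>M)"
proof (cases "integrable M h")
  case True
  then have fin: "(\<integral>\<^sup>+ x. ennreal (h x) \<partial>M) < \<infinity>"
    by (auto simp: real_integrable_def less_top)
  have "(\<integral>x. h x \<partial>M) \<le> enn2real (\<integral>\<^sup>+ x. ennreal (h x) \<partial>M)"
    unfolding real_lebesgue_integral_def[OF True] by simp
  then have "ennreal (\<integral>x. h x \<partial>M) \<le> ennreal (enn2real (\<integral>\<^sup>+ x. ennreal (h x) \<partial>M))"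
    by (rule ennreal_leI)
  also have "\<dots> = (\<integral>\<^sup>+ x. ennreal (h x) \<partial>M)"
    using fin by (intro ennreal_enn2real) simp
  finally show ?thesis .
\<comment> \<open>A non-integrable function has Bochner integral 0 by default, so the inequality
  holds there as well.\<close>
qed (simp add: not_integrable_integral_eq)

text \<open>Values of \<open>g\<close> up to the threshold \<mu>/(2V), with V the volume of the unit
  ball, contribute at most half of \<mu> r^n over a ball of volume V r^n. The other half must come
  from the values above the threshold.\<close>

lemma nn_integral_cball_truncate:
  fixes g :: "'a::euclidean_space \<Rightarrow> real"
  assumes g[measurable]: "g \<in> borel_measurable borel" and "0 < r" "0 < \<mu>"
    and large: "ennreal (\<mu> * r ^ DIM('a)) < (\<integral>\<^sup>+ x \<in> cball a r. ennreal (g x) \<partial>lborel)"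
  shows "ennreal (\<mu> / 2 * r ^ DIM('a)) \<le>
    (\<integral>\<^sup>+ x \<in> cball a r. (ennreal (g x) * indicator {x. \<mu> / (2 * unit_ball_vol DIM('a)) < g x} x) \<partial>lborel)"
    (is "?a \<le> ?X")
proof -
  let ?m = "\<mu> / (2 * unit_ball_vol DIM('a))"
  have V: "0 < unit_ball_vol DIM('a)" by (intro unit_ball_vol_pos) simp
  then have V0: "unit_ball_vol DIM('a) \<noteq> 0" by (rule less_imp_neq[symmetric])
  have [measurable]: "cball a r \<in> sets borel" by simp
  have "(\<integral>\<^sup>+ x \<in> cball a r. ennreal (g x) \<partial>lborel) \<le>
      (\<integral>\<^sup>+ x. ennreal (g x) * indicator {x. ?m < g x} x * indicator (cball a r) x
        + ennreal ?m * indicator (cball a r) x \<partial>lborel)"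
    by (intro nn_integral_mono) (auto simp: indicator_def intro: ennreal_leI)
  also have "\<dots> = ?X + (\<integral>\<^sup>+ x. ennreal ?m * indicator (cball a r) x \<partial>lborel)"
    by (rule nn_integral_add) measurable
  also have "(\<integral>\<^sup>+ x. ennreal ?m * indicator (cball a r) x \<partial>lborel) = ennreal ?m * emeasure lborel (cball a r)"
    by (rule nn_integral_cmult_indicator) simp
  also have "ennreal ?m * emeasure lborel (cball a r) = ?a"
    using assms V V0 by (simp add: emeasure_cball flip: ennreal_mult)
  finally have "ennreal (\<mu> * r ^ DIM('a)) < ?X + ?a"
    using large by simp
  moreover have "ennreal (\<mu> * r ^ DIM('a)) = ?a + ?a"
    using assms by (simp flip: ennreal_plus)
  ultimately have *: "?a + ?a < ?X + ?a" by simp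
  \<comment> \<open>The strict inequality in \<open>large\<close> yields the contradiction by
    monotonicity of addition, without subtraction in \<open>ennreal\<close>.\<close>
  show ?thesis
  proof (rule ccontr)
    assume "\<not> ?thesis"
    then have "?X + ?a \<le> ?a + ?a" by (intro add_right_mono) simp
    with * show False by (meson leD)
  qed
qed

text \<open>If the averages were small at every radius from t on, inserting them at the radii 2^j t
  into the dyadic bound would leave a geometric series with ratio 2^(-\<alpha>). The constant in the
  conclusion is chosen so that this series sums to s/2, which contradicts the assumed value of at
  least s.\<close>

lemma CS_extension_large_average:
  fixes f g :: "real ^ 'n \<Rightarrow> real"
  assumes "0 < \<alpha>" "0 < t" "0 < s" "s \<le> CS_extension \<alpha> f x t"
    and g[measurable]: "g \<in> borel_measurable borel" and fg: "AE y in lborel. f y = g y"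
  shows "\<exists>r\<ge>t. ennreal ((1 - 2 powr - \<alpha>)
      / (2 * (CS_const CARD('n) \<alpha> * 2 powr (real CARD('n) + \<alpha>))) * s * r ^ CARD('n))
    < (\<integral>\<^sup>+ y \<in> cball x r. ennreal (g y) \<partial>lborel)"
proof (rule ccontr)
  let ?A = "CS_const CARD('n) \<alpha> * 2 powr (real CARD('n) + \<alpha>)" and ?q = "2 powr - \<alpha> :: real"
  let ?\<mu> = "(1 - ?q) / (2 * ?A) * s"
  let ?w = "\<lambda>j. ?A * ?q ^ j / (2 ^ j * t) ^ CARD('n)"
  assume "\<not> ?thesis"
  then have avg: "(\<integral>\<^sup>+ y \<in> cball x r. ennreal (g y) \<partial>lborel) \<le> ennreal (?\<mu> * r ^ CARD('n))"
    if "t \<le> r" for r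
    using that by (auto simp: not_less)
  have q: "0 < ?q" "?q < 1" using assms by (auto simp: powr_less_one)
  have A: "0 < ?A" using CS_const_pos[of "CARD('n)" \<alpha>] assms by simp
  have \<mu>: "0 < ?\<mu>" using q A assms by simp
  have [measurable]: "cball x r \<in> sets borel" for r by simp
  have "ennreal s \<le> ennreal (CS_extension \<alpha> f x t)" using assms by (intro ennreal_leI)
  also have "\<dots> \<le> (\<integral>\<^sup>+ y. ennreal (CS_kernel \<alpha> t (x - y) * f y) \<partial>lebesgue)"
    unfolding CS_extension_def by (rule ennreal_integral_le_nn_integral)
  also have "\<dots> = (\<integral>\<^sup>+ y. ennreal (CS_kernel \<alpha> t (x - y)) * ennreal (g y) \<partial>lborel)"
    unfolding nn_integral_completion using fg assms
    by (intro nn_integral_cong_AE) (auto simp: ennreal_mult' CS_kernel_nonneg)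
  also have "\<dots> \<le> (\<integral>\<^sup>+ y. (\<Sum>j. ennreal (?w j) * (ennreal (g y) * indicator (cball x (2 ^ j * t)) y)) \<partial>lborel)"
  proof (intro nn_integral_mono)
    fix y
    have "ennreal (CS_kernel \<alpha> t (x - y)) * ennreal (g y)
      \<le> (\<Sum>j. ennreal (?w j) * indicator (cball 0 (2 ^ j * t)) (x - y)) * ennreal (g y)"
      using assms by (intro mult_right_mono CS_kernel_le_dyadic) auto
    also have "\<dots> = (\<Sum>j. ennreal (?w j) * indicator (cball 0 (2 ^ j * t)) (x - y) * ennreal (g y))"
      by simp
    also have "\<dots> = (\<Sum>j. ennreal (?w j) * (ennreal (g y) * indicator (cball x (2 ^ j * t)) y))"
      by (intro suminf_cong) (auto simp: indicator_def dist_norm norm_minus_commute)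
    finally show "ennreal (CS_kernel \<alpha> t (x - y)) * ennreal (g y) \<le> \<dots>" .
  qed
  also have "\<dots> = (\<Sum>j. ennreal (?w j) * (\<integral>\<^sup>+ y \<in> cball x (2 ^ j * t). ennreal (g y) \<partial>lborel))"
    by (subst nn_integral_suminf) (measurable, intro suminf_cong nn_integral_cmult, measurable)
  \<comment> \<open>The radii 2^j t are all at least t, and the factor (2^j t)^n cancels against the
    weight \<open>?w j\<close>.\<close>
  also have "\<dots> \<le> (\<Sum>j. ennreal (?w j) * ennreal (?\<mu> * (2 ^ j * t) ^ CARD('n)))"
    using assms by (intro suminf_le mult_left_mono avg) auto
  also have "\<dots> = (\<Sum>j. ennreal (?A * ?\<mu> * ?q ^ j))"
  proof (intro suminf_cong)
    fix j
    have "?w j * (?\<mu> * (2 ^ j * t) ^ CARD('n)) = ?A * ?\<mu> * ?q ^ j"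
      using assms by simp
    then show "ennreal (?w j) * ennreal (?\<mu> * (2 ^ j * t) ^ CARD('n)) = ennreal (?A * ?\<mu> * ?q ^ j)"
      using A \<mu> q assms by (subst ennreal_mult'[symmetric]) auto
  qed
  also have "\<dots> = ennreal (?A * ?\<mu> * (1 / (1 - ?q)))"
    using q A \<mu> assms CS_const_pos[of "CARD('n)" \<alpha>]
    by (intro suminf_ennreal_eq sums_mult geometric_sums mult_nonneg_nonneg zero_le_power) simp_all
  also have "?A * ?\<mu> * (1 / (1 - ?q)) = s / 2"
  proof -
    have *: "a * (d / (2 * a) * s) * (1 / d) = s / 2" if "a \<noteq> 0" "d \<noteq> 0" for a d :: real
      using that by simp
    show ?thesis by (intro * less_imp_neq[symmetric]) (use q A in simp_all)
  qed
  finally show False using assms by simp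
qed

text \<open>The constants are fixed before \<open>f\<close>, \<open>g\<close> and \<open>s\<close>,
  which allows integration in the level later. Keeping only the values of \<open>g\<close> above
  \<open>c * s\<close> is what makes that integral converge to a multiple of the p-th power
  norm.\<close>

lemma emeasure_nontangential_le:
  assumes "0 < \<alpha>"
  shows "\<exists>c>0. \<exists>D>0. \<forall>f g s. 0 < s \<longrightarrow> g \<in> borel_measurable borel \<longrightarrow> (AE y in lborel. f y = g y) \<longrightarrow>
      emeasure lborel (\<Union>(x, t) \<in> {(x, t) \<in> upper_half_space. s \<le> CS_extension \<alpha> f x t}. ball (x :: real ^ 'n) t)
      \<le> ennreal (D / s) * (\<integral>\<^sup>+ y. ennreal (g y) * indicator {y. c * s < g y} y \<partial>lborel)"
proof -
  define \<mu> where "\<mu> = (1 - 2 powr - \<alpha>) / (2 * (CS_const CARD('n) \<alpha> * 2 powr (real CARD('n) + \<alpha>)))"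
  let ?V = "unit_ball_vol (real CARD('n))"
  \<comment> \<open>\<open>?c\<close> is the truncation threshold per unit of s. In
    \<open>?D\<close> the 2 pays for the half lost in truncating, and the power of 5 for the Vitali
    enlargement.\<close>
  let ?c = "\<mu> / (2 * ?V)" and ?D = "2 * ?V * 5 ^ CARD('n) / \<mu>"
  have "(2::real) powr - \<alpha> < 1" using assms by (auto simp: powr_less_one)
  then have \<mu>: "0 < \<mu>" unfolding \<mu>_def using CS_const_pos[of "CARD('n)" \<alpha>] assms by simp
  have V: "0 < ?V" by (intro unit_ball_vol_pos) simp
  have bound: "emeasure lborel (\<Union>(x, t) \<in> {(x, t) \<in> upper_half_space. s \<le> CS_extension \<alpha> f x t}. ball x t)
      \<le> ennreal (?D / s) * (\<integral>\<^sup>+ y. ennreal (g y) * indicator {y. ?c * s < g y} y \<partial>lborel)"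
    if s: "0 < s" and g: "g \<in> borel_measurable borel" "AE y in lborel. f y = g y"
    for s and f g :: "real ^ 'n \<Rightarrow> real"
  proof -
    let ?h = "\<lambda>y. ennreal (g y) * indicator {y. ?c * s < g y} y"
    let ?S = "\<Union>(x, t) \<in> {(x, t) \<in> upper_half_space. s \<le> CS_extension \<alpha> f x t}. ball x t"
    \<comment> \<open>The covering balls are the larger ones on which the truncated average is big,
      rather than the balls \<open>ball x t\<close> themselves; r being at least t makes them
      cover.\<close>
    define K where "K = {(x, r). 0 < r \<and>
      ennreal (\<mu> * s / 2 * r ^ CARD('n)) \<le> (\<integral>\<^sup>+ y \<in> cball x r. ?h y \<partial>lborel)}"
    have cover: "?S \<subseteq> (\<Union>i\<in>K. cball (fst i) (snd i))"
    proof
      fix z assume "z \<in> ?S"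
      then obtain x t where z: "z \<in> ball x t" "0 < t" "s \<le> CS_extension \<alpha> f x t"
        by (auto simp: upper_half_space_def)
      obtain r where r: "t \<le> r"
          "ennreal (\<mu> * s * r ^ CARD('n)) < (\<integral>\<^sup>+ y \<in> cball x r. ennreal (g y) \<partial>lborel)"
        using CS_extension_large_average[OF assms z(2) s z(3) g] unfolding \<mu>_def by blast
      have "ennreal (\<mu> * s / 2 * r ^ CARD('n)) \<le> (\<integral>\<^sup>+ y \<in> cball x r. ?h y \<partial>lborel)"
        using nn_integral_cball_truncate[of g r "\<mu> * s" x] g(1) r z(2) \<mu> s by (simp add: mult.assoc)
      then have "(x, r) \<in> K" using r z by (simp add: K_def)
      moreover have "z \<in> cball x r" using z r by auto
      ultimately show "z \<in> (\<Union>i\<in>K. cball (fst i) (snd i))" by force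
    qed
    have "emeasure lborel ?S \<le> ennreal (?V * 5 ^ CARD('n) / (\<mu> * s / 2)) * (\<integral>\<^sup>+ y. ?h y \<partial>lborel)"
      using emeasure_le_of_averages_ge[OF _ cover, of ?h "\<mu> * s / 2"] g \<mu> s
      by (auto simp: K_def)
    also have "?V * 5 ^ CARD('n) / (\<mu> * s / 2) = ?D / s"
      using \<mu> s by simp
    finally show ?thesis .
  qed
  have "0 < ?c" "0 < ?D" using V \<mu> by simp_all
  then show ?thesis using bound by blast
qed

section \<open>Integration over the levels\<close>

lemma nn_integral_powr_Ioo:
  fixes a q :: real
  assumes "-1 < q" "0 \<le> a"
  shows "(\<integral>\<^sup>+ s \<in> {0<..<a}. ennreal (s powr q) \<partial>lborel) = ennreal (a powr (q + 1) / (q + 1))"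
proof -
  have "(\<integral>\<^sup>+ s \<in> {0<..<a}. ennreal (s powr q) \<partial>lborel) = (\<integral>\<^sup>+ s \<in> {0..a}. ennreal (s powr q) \<partial>lborel)"
    using AE_lborel_singleton[of 0] AE_lborel_singleton[of a]
    by (intro nn_integral_cong_AE) (auto simp: indicator_def)
  also have "\<dots> = ennreal (a powr (q + 1) / (q + 1))"
    using assms by (intro nn_integral_has_integral_lebesgue' has_integral_powr_from_0) auto
  finally show ?thesis .
qed

text \<open>After Tonelli, for fixed y with g y positive the truncation says that s runs over the
  interval from 0 to g y / c. Since p - 2 exceeds -1, the inner integral is g y (g y / c)^(p-1) /
  (p-1), a multiple of (g y)^p.\<close>

lemma nn_integral_truncations:
  fixes g :: "'a::euclidean_space \<Rightarrow> real"
  assumes g[measurable]: "g \<in> borel_measurable borel" and "1 < p" "0 < c"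
  shows "(\<integral>\<^sup>+ s \<in> {0<..}. ((\<integral>\<^sup>+ y. ennreal (g y) * indicator {y. c * s < g y} y \<partial>lborel)
        * ennreal (s powr (p - 2))) \<partial>lborel)
    \<le> ennreal (c powr (1 - p) / (p - 1)) * (\<integral>\<^sup>+ y. ennreal (\<bar>g y\<bar> powr p) \<partial>lborel)"
proof -
  have "(\<integral>\<^sup>+ s \<in> {0<..}. ((\<integral>\<^sup>+ y. ennreal (g y) * indicator {y. c * s < g y} y \<partial>lborel)
        * ennreal (s powr (p - 2))) \<partial>lborel)
    = (\<integral>\<^sup>+ s. (\<integral>\<^sup>+ y. ennreal (g y) * indicator {y. c * s < g y} y
        * (ennreal (s powr (p - 2)) * indicator {0<..} s) \<partial>lborel) \<partial>lborel)"
    by (intro nn_integral_cong, subst mult.assoc, intro nn_integral_multc[symmetric]) measurable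
  also have "\<dots> = (\<integral>\<^sup>+ y. (\<integral>\<^sup>+ s. ennreal (g y) * indicator {y. c * s < g y} y
        * (ennreal (s powr (p - 2)) * indicator {0<..} s) \<partial>lborel) \<partial>lborel)"
    by (intro lborel_pair.Fubini') measurable
  also have "\<dots> \<le> (\<integral>\<^sup>+ y. ennreal (c powr (1 - p) / (p - 1)) * ennreal (\<bar>g y\<bar> powr p) \<partial>lborel)"
  proof (intro nn_integral_mono)
    fix y
    have "(\<integral>\<^sup>+ s. ennreal (g y) * indicator {y. c * s < g y} y
        * (ennreal (s powr (p - 2)) * indicator {0<..} s) \<partial>lborel)
      = (\<integral>\<^sup>+ s. ennreal (g y) * (ennreal (s powr (p - 2)) * indicator {0<..<g y / c} s) \<partial>lborel)"
      using assms(3) by (intro nn_integral_cong) (auto simp: indicator_def field_simps)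
    also have "\<dots> = ennreal (g y) * (\<integral>\<^sup>+ s \<in> {0<..<g y / c}. ennreal (s powr (p - 2)) \<partial>lborel)"
      by (intro nn_integral_cmult) measurable
    also have "\<dots> \<le> ennreal (c powr (1 - p) / (p - 1)) * ennreal (\<bar>g y\<bar> powr p)"
    proof (cases "0 < g y")
      case True
      have "c powr (1 - p) = 1 / c powr (p - 1)"
        using powr_minus_divide[of c "p - 1"] by simp
      then have 1: "(g y / c) powr (p - 1) = g y powr (p - 1) * c powr (1 - p)"
        using True assms(3) by (simp add: powr_divide)
      have 2: "g y * g y powr (p - 1) = g y powr p"
        using True by (simp add: powr_mult_base)
      have "g y * ((g y / c) powr (p - 1) / (p - 1)) = c powr (1 - p) / (p - 1) * (g y * g y powr (p - 1))"
        unfolding 1 by simp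
      then have "g y * ((g y / c) powr (p - 1) / (p - 1)) = c powr (1 - p) / (p - 1) * \<bar>g y\<bar> powr p"
        unfolding 2 using True by simp
      then show ?thesis
        using True assms nn_integral_powr_Ioo[of "p - 2" "g y / c"] by (simp flip: ennreal_mult')
    next
      case False
      then have "ennreal (g y) = 0" by (intro ennreal_neg) simp
      then show ?thesis by simp
    qed
    finally show "(\<integral>\<^sup>+ s. ennreal (g y) * indicator {y. c * s < g y} y
        * (ennreal (s powr (p - 2)) * indicator {0<..} s) \<partial>lborel) \<le> \<dots>" .
  qed
  also have "\<dots> = ennreal (c powr (1 - p) / (p - 1)) * (\<integral>\<^sup>+ y. ennreal (\<bar>g y\<bar> powr p) \<partial>lborel)"
    by (intro nn_integral_cmult) measurable
  finally show ?thesis .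
qed

lemma Lp_norm_powr:
  assumes "1 < p" "f \<in> Lp_space p"
  shows "ennreal (Lp_norm p f powr p) = (\<integral>\<^sup>+ x. ennreal (\<bar>f x\<bar> powr p) \<partial>lborel)"
proof -
  have "Lp_norm p f powr p = (\<integral>x. \<bar>f x\<bar> powr p \<partial>lebesgue)"
    using assms by (simp add: Lp_norm_def powr_powr)
  also have "ennreal \<dots> = (\<integral>\<^sup>+ x. ennreal (\<bar>f x\<bar> powr p) \<partial>lebesgue)"
    using assms by (intro nn_integral_eq_integral[symmetric]) (auto simp: Lp_space_def)
  finally show ?thesis by (simp add: nn_integral_completion)
qed

section \<open>Capacity bounded by the measure of a union of balls\<close>

lemma CS_extension_indicator_ge:
  fixes G :: "(real ^ 'n) set"
  assumes "0 < \<alpha>" "0 < t" "open G" "emeasure lborel G < \<infinity>" "ball x t \<subseteq> G"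
  shows "CS_const CARD('n) \<alpha> * 2 powr (- (real CARD('n) + \<alpha>) / 2) * unit_ball_vol CARD('n)
    \<le> CS_extension \<alpha> (indicator G) x t"
proof -
  \<comment> \<open>\<open>?k\<close> bounds the kernel from below on \<open>ball x t\<close>; its
    t^(-n) cancels the volume of the ball, so the final bound is independent of t.\<close>
  let ?k = "CS_const CARD('n) \<alpha> * 2 powr (- (real CARD('n) + \<alpha>) / 2) / t ^ CARD('n)"
  let ?M = "CS_const CARD('n) \<alpha> * t powr \<alpha> * (t\<^sup>2) powr (- (real CARD('n) + \<alpha>) / 2)"
  have int: "integrable lebesgue (indicator A :: real ^ 'n \<Rightarrow> real)"
    if "open A" "emeasure lborel A < \<infinity>" for A
    using that by (simp add: integrable_indicator_iff)
  have b_int: "integrable lebesgue (indicator (ball x t) :: real ^ 'n \<Rightarrow> real)"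
    using assms by (intro int) (auto simp: emeasure_ball)
  have meas: "(\<lambda>y. CS_kernel \<alpha> t (x - y)) \<in> borel_measurable borel"
    by (rule measurable_compose[OF _ borel_measurable_continuous_onI[OF continuous_on_CS_kernel[OF assms(2)]]])
      measurable
  \<comment> \<open>The kernel is largest at the origin, with value \<open>?M\<close>. This gives
    the integrability over \<open>G\<close> that rules out the default value 0 of the
    integral.\<close>
  have le: "CS_kernel \<alpha> t z \<le> ?M" for z :: "real ^ 'n"
    unfolding CS_kernel_def using assms CS_const_pos[of "CARD('n)" \<alpha>]
    by (intro mult_left_mono powr_mono2') auto
  have "?k * (unit_ball_vol CARD('n) * t ^ CARD('n)) = (\<integral>y. ?k * indicator (ball x t) y \<partial>lebesgue)"
    using assms by (simp add: content_ball)
  also have "\<dots> \<le> (\<integral>y. CS_kernel \<alpha> t (x - y) * indicator G y \<partial>lebesgue)"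
  proof (rule integral_mono)
    show "integrable lebesgue (\<lambda>y. ?k * indicator (ball x t) y)"
      using b_int by (rule integrable_mult_right)
    show "integrable lebesgue (\<lambda>y. CS_kernel \<alpha> t (x - y) * indicator G y)"
    proof (rule Bochner_Integration.integrable_bound[OF integrable_mult_right[OF int[OF assms(3,4)]]])
      show "(\<lambda>y. CS_kernel \<alpha> t (x - y) * indicator G y) \<in> borel_measurable lebesgue"
        using meas assms(3) by (intro borel_measurable_times measurable_completion) auto
      show "AE y in lebesgue. norm (CS_kernel \<alpha> t (x - y) * indicator G y) \<le> norm (?M * indicator G y)"
      proof (rule AE_I2)
        fix y
        have "\<bar>CS_kernel \<alpha> t (x - y)\<bar> \<le> \<bar>?M\<bar>"
          unfolding abs_of_nonneg[OF CS_kernel_nonneg[OF assms(1)]] by (rule order_trans[OF le abs_ge_self])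
        then show "norm (CS_kernel \<alpha> t (x - y) * indicator G y) \<le> norm (?M * indicator G y)"
          unfolding real_norm_def abs_mult by (rule mult_right_mono) simp
      qed
    qed
    fix y
    show "?k * indicator (ball x t) y \<le> CS_kernel \<alpha> t (x - y) * indicator G y"
    proof (cases "y \<in> ball x t")
      case True
      then have "norm (x - y) \<le> t" by (simp add: dist_norm)
      then show ?thesis using True CS_kernel_ge[OF assms(1,2), of "x - y"] assms(5) by (auto simp: indicator_def)
    qed (use CS_kernel_nonneg[OF assms(1)] in \<open>auto simp: indicator_def\<close>)
  qed
  also have "\<dots> = CS_extension \<alpha> (indicator G) x t"
    unfolding CS_extension_def ..
  finally show ?thesis using assms by simp
qed

text \<open>The indicator of the union, divided by the lower bound \<open>b\<close> for its
  extension, is admissible for \<open>E\<close>, and the p-th power of its norm is b^(-p) times the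
  measure of the union.\<close>

lemma Lp_capacity_le:
  fixes p \<alpha> :: real
  assumes "0 < \<alpha>" "1 < p"
  shows "\<exists>B>0. \<forall>E \<subseteq> upper_half_space.
    Lp_capacity \<alpha> p E \<le> ennreal B * emeasure lborel (\<Union>(x, t) \<in> E. ball (x :: real ^ 'n) t)"
proof -
  define b where "b = CS_const CARD('n) \<alpha> * 2 powr (- (real CARD('n) + \<alpha>) / 2) * unit_ball_vol CARD('n)"
  have "0 < unit_ball_vol (real CARD('n))" by (intro unit_ball_vol_pos) simp
  then have b: "0 < b" using CS_const_pos[of "CARD('n)" \<alpha>] assms by (simp add: b_def)
  let ?B = "(1 / b) powr p"
  have "Lp_capacity \<alpha> p E \<le> ennreal ?B * emeasure lborel (\<Union>(x, t) \<in> E. ball x t)"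
    if E: "E \<subseteq> upper_half_space" for E :: "((real ^ 'n) \<times> real) set"
  proof -
    define G where "G = (\<Union>(x, t) \<in> E. ball x t)"
    have G: "open G" unfolding G_def by auto
    show ?thesis
    \<comment> \<open>The test function lies in \<open>Lp_space p\<close> only when \<open>G\<close>
      has finite measure; otherwise the right-hand side is infinite because \<open>?B\<close> is
      positive.\<close>
    proof (cases "emeasure lborel G = \<infinity>")
      case True
      then show ?thesis using b by (simp add: G_def ennreal_mult_top)
    next
      case False
      then have fin: "emeasure lborel G < \<infinity>" by (simp add: less_top)
      let ?h = "\<lambda>y. 1 / b * indicator G y"
      have h_powr: "\<bar>?h y\<bar> powr p = ?B * indicator G y" for y
        using b by (simp add: indicator_def)
      have meas: "?h \<in> borel_measurable lebesgue"
        using G by (intro borel_measurable_times measurable_completion) auto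
      have "integrable lebesgue (indicator G :: real ^ 'n \<Rightarrow> real)"
        using G fin by (simp add: integrable_indicator_iff)
      then have "integrable lebesgue (\<lambda>y. \<bar>?h y\<bar> powr p)"
        unfolding h_powr by (rule integrable_mult_right)
      then have h: "?h \<in> Lp_space p"
        using meas unfolding Lp_space_def by blast
      have ext: "1 \<le> CS_extension \<alpha> ?h x t" if "(x, t) \<in> E" for x t
      proof -
        have "0 < t" "ball x t \<subseteq> G" using that E by (auto simp: upper_half_space_def G_def)
        then have "b \<le> CS_extension \<alpha> (indicator G) x t"
          unfolding b_def using assms G fin by (intro CS_extension_indicator_ge) auto
        moreover have "CS_extension \<alpha> ?h x t = 1 / b * CS_extension \<alpha> (indicator G) x t"
          unfolding CS_extension_def by (subst integral_mult_right_zero[symmetric]) (simp add: mult_ac)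
        ultimately show ?thesis using b by simp
      qed
      have "Lp_capacity \<alpha> p E \<le> ennreal (Lp_norm p ?h powr p)"
        unfolding Lp_capacity_def using h ext b by (intro INF_lower) auto
      also have "\<dots> = (\<integral>\<^sup>+ x. ennreal (\<bar>?h x\<bar> powr p) \<partial>lborel)"
        by (rule Lp_norm_powr[OF assms(2) h])
      also have "\<dots> = (\<integral>\<^sup>+ x. ennreal ?B * indicator G x \<partial>lborel)"
        unfolding h_powr by (intro nn_integral_cong) (simp add: indicator_def)
      also have "\<dots> = ennreal ?B * emeasure lborel G"
        using G by (intro nn_integral_cmult_indicator) auto
      finally show ?thesis unfolding G_def .
    qed
  qed
  moreover have "0 < ?B" using b by simp
  ultimately show ?thesis by blast
qed

section \<open>The strong-type capacitary inequality\<close>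

theorem lemma2p11:
  fixes \<alpha> p :: real
  assumes "0 < \<alpha>" and "\<alpha> < 2" and "1 < p"
  shows "\<exists>C>0. \<forall>f :: real ^ 'n \<Rightarrow> real.
           f \<in> Lp_space p \<longrightarrow> (AE x in lebesgue. 0 \<le> f x) \<longrightarrow>
           (\<integral>\<^sup>+ s \<in> {0<..}.
              (Lp_capacity \<alpha> p {(x, t) \<in> upper_half_space. s \<le> CS_extension \<alpha> f x t}
                * ennreal (p * s powr (p - 1))) \<partial>lborel)
           \<le> ennreal (C * Lp_norm p f powr p)"
proof -
  obtain B where B: "0 < B" "\<And>E. E \<subseteq> upper_half_space \<Longrightarrow>
      Lp_capacity \<alpha> p E \<le> ennreal B * emeasure lborel (\<Union>(x, t) \<in> E. ball (x :: real ^ 'n) t)"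
    using Lp_capacity_le[OF assms(1,3)] by blast
  obtain c D where c: "0 < c" and D: "0 < D" and
    level: "\<And>f g s. 0 < s \<Longrightarrow> g \<in> borel_measurable borel \<Longrightarrow> AE y in lborel. f y = g y \<Longrightarrow>
      emeasure lborel (\<Union>(x, t) \<in> {(x, t) \<in> upper_half_space. s \<le> CS_extension \<alpha> f x t}. ball (x :: real ^ 'n) t)
      \<le> ennreal (D / s) * (\<integral>\<^sup>+ y. ennreal (g y) * indicator {y. c * s < g y} y \<partial>lborel)"
    using emeasure_nontangential_le[OF assms(1)] by blast
  \<comment> \<open>\<open>B\<close> comes from the capacity bound, \<open>D\<close> from the
    level-set estimate, \<open>p\<close> from the measure d(s^p), and the last factor from
    integrating the truncations.\<close>
  let ?C = "B * D * p * (c powr (1 - p) / (p - 1))"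
  have "(\<integral>\<^sup>+ s \<in> {0<..}. (Lp_capacity \<alpha> p {(x, t) \<in> upper_half_space. s \<le> CS_extension \<alpha> f x t}
        * ennreal (p * s powr (p - 1))) \<partial>lborel) \<le> ennreal (?C * Lp_norm p f powr p)"
    if f: "f \<in> Lp_space p" for f :: "real ^ 'n \<Rightarrow> real"
  proof -
    have "f \<in> borel_measurable lebesgue" using f by (simp add: Lp_space_def)
    \<comment> \<open>Tonelli needs joint measurability in y and s, which a Borel representative of
      the Lebesgue measurable \<open>f\<close> provides.\<close>
    then obtain g where g[measurable]: "g \<in> borel_measurable borel" and fg: "AE y in lborel. f y = g y"
      using completion_ex_borel_measurable_real[of f lborel] by auto
    let ?T = "\<lambda>s. \<integral>\<^sup>+ y. ennreal (g y) * indicator {y. c * s < g y} y \<partial>lborel"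
    have "(\<integral>\<^sup>+ s \<in> {0<..}. (Lp_capacity \<alpha> p {(x, t) \<in> upper_half_space. s \<le> CS_extension \<alpha> f x t}
        * ennreal (p * s powr (p - 1))) \<partial>lborel)
      \<le> (\<integral>\<^sup>+ s. ennreal (B * D * p) * (?T s * ennreal (s powr (p - 2)) * indicator {0<..} s) \<partial>lborel)"
    \<comment> \<open>The comparison is pointwise in s, so the capacity is never treated as a
      measurable function of the level.\<close>
    proof (intro nn_integral_mono)
      fix s :: real
      let ?E = "{(x, t) \<in> upper_half_space. s \<le> CS_extension \<alpha> f x t}"
      show "Lp_capacity \<alpha> p ?E * ennreal (p * s powr (p - 1)) * indicator {0<..} s
        \<le> ennreal (B * D * p) * (?T s * ennreal (s powr (p - 2)) * indicator {0<..} s)"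
      proof (cases "0 < s")
        case True
        have "Lp_capacity \<alpha> p ?E \<le> ennreal B * emeasure lborel (\<Union>(x, t) \<in> ?E. ball x t)"
          by (intro B) auto
        also have "\<dots> \<le> ennreal B * (ennreal (D / s) * ?T s)"
          by (intro mult_left_mono level True g fg) auto
        finally have "Lp_capacity \<alpha> p ?E * ennreal (p * s powr (p - 1))
          \<le> ennreal B * (ennreal (D / s) * ?T s) * ennreal (p * s powr (p - 1))"
          by (rule mult_right_mono) auto
        also have "\<dots> = ennreal B * ennreal (D / s) * ennreal (p * s powr (p - 1)) * ?T s"
          by (simp only: ac_simps)
        also have "ennreal B * ennreal (D / s) * ennreal (p * s powr (p - 1))
          = ennreal (B * (D / s) * (p * s powr (p - 1)))"
          using B(1) D True assms(3)
          by (simp only: ennreal_mult mult_nonneg_nonneg divide_nonneg_nonneg powr_ge_zero less_imp_le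
              order.strict_trans[OF zero_less_one])
        \<comment> \<open>The factor 1/s of the level-set estimate lowers the exponent p - 1 to p -
          2.\<close>
        also have "B * (D / s) * (p * s powr (p - 1)) = B * D * p * s powr (p - 2)"
          using True powr_mult_base[of s "p - 2"] by (simp add: field_simps)
        also have "ennreal (B * D * p * s powr (p - 2)) = ennreal (B * D * p) * ennreal (s powr (p - 2))"
          using B(1) D assms(3) by (intro ennreal_mult) auto
        finally show ?thesis using True by (simp add: ac_simps)
      qed simp
    qed
    also have "\<dots> = ennreal (B * D * p) * (\<integral>\<^sup>+ s \<in> {0<..}. (?T s * ennreal (s powr (p - 2))) \<partial>lborel)"
      by (intro nn_integral_cmult) measurable
    also have "\<dots> \<le> ennreal (B * D * p) * (ennreal (c powr (1 - p) / (p - 1))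
        * (\<integral>\<^sup>+ y. ennreal (\<bar>g y\<bar> powr p) \<partial>lborel))"
      by (intro mult_left_mono nn_integral_truncations g assms(3) c) auto
    also have "(\<integral>\<^sup>+ y. ennreal (\<bar>g y\<bar> powr p) \<partial>lborel) = (\<integral>\<^sup>+ y. ennreal (\<bar>f y\<bar> powr p) \<partial>lborel)"
      using fg by (intro nn_integral_cong_AE) auto
    also have "\<dots> = ennreal (Lp_norm p f powr p)"
      by (rule Lp_norm_powr[OF assms(3) f, symmetric])
    also have "ennreal (B * D * p) * (ennreal (c powr (1 - p) / (p - 1)) * ennreal (Lp_norm p f powr p))
      = ennreal (?C * Lp_norm p f powr p)"
    proof -
      have "0 \<le> c powr (1 - p) / (p - 1)" "0 \<le> B * D * p" using B(1) D assms(3) by simp_all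
      then show ?thesis by (simp only: ennreal_mult'[symmetric] mult.assoc)
    qed
    finally show ?thesis .
  qed
  moreover have "0 < ?C" using B(1) D c assms(3) by simp
  ultimately show ?thesis by blast
qed

end
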